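(* Let $\nu=(\lambda,t)\in N_1\cup N_2\cup N_3$ and $q=(x,y,z)=Exp(\nu)$, and let $R_1(q)=y\cosh\frac z2-x\sinh\frac z2$ and $R_2(q)=x\cosh\frac z2-y\sinh\frac z2$. Then: (1) $\nu\in MAX^1$ if and only if: $R_1(q)=0$ and $\mathrm{cn}\,\tau\neq0$, in case $\lambda\in C_1$; $R_1(q)=0$, in case $\lambda\in C_2\cup C_3$. (2) $\nu\in MAX^2$ if and only if: $z=0$ and $\mathrm{sn}\,\tau\neq0$, in case $\lambda\in C_1\cup C_2$; $z=0$ and $\tau\ne0$, in case $\lambda\in C_3$. (3) $\nu\in MAX^6$ if and only if: $R_2(q)=0$ and $\mathrm{cn}\,\tau\ne0$, in case $\lambda\in C_2$; $R_2(q)=0$, in case $\lambda\in C_1\cup C_3$.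
   Context: Phase cylinder: $C=(\mathbb{R}/4\pi\mathbb{Z})\times\mathbb{R}\ni\lambda=(\gamma,c)$; $N=C\times\mathbb{R}^+$. For $\lambda=(\gamma,c)\in C$ let $(\gamma_s,c_s,x_s,y_s,z_s)$ be the solution of $$\dot\gamma=c,\quad \dot c=-\sin\gamma,\quad \dot x=\cos\tfrac{\gamma}{2}\cosh z,\quad \dot y=\cos\tfrac{\gamma}{2}\sinh z,\quad \dot z=\sin\tfrac{\gamma}{2}$$ with initial values $(\gamma_0,c_0)=(\gamma,c)$, $x_0=y_0=z_0=0$ (these are the arc-length parametrized normal extremals from the identity of the left-invariant sub-Riemannian structure on $M=\mathrm{SH}(2)\cong\mathbb{R}^3_{x,y,z}$ with orthonormal frame $\cosh z\,\partial_x+\sinh z\,\partial_y$, $\partial_z$). The exponential mapping is $Exp:N\to M$, $Exp(\lambda,s)=(x_s,y_s,z_s)$. Energy $E=\frac{c^2}{2}-\cos\gamma$; $C_1=\{E\in(-1,1)\}$, $C_2=\{E\in(1,\infty)\}$, $C_3=\{E=1,\ c\neq0\}$; $N_i=C_i\times\mathbb{R}^+$. Elliptic coordinates $(\varphi,k)$ of $\lambda=(\gamma,c)$, with $s_1=\mathrm{sgn}(\cos\frac\gamma2)$, $s_2=\mathrm{sgn}(c)$: - on $C_1$: $k=\sqrt{(E+1)/2}\in(0,1)$, $\sin\frac\gamma2=s_1k\,\mathrm{sn}(\varphi,k)$, $\cos\frac\gamma2=s_1\mathrm{dn}(\varphi,k)$, $\frac c2=k\,\mathrm{cn}(\varphi,k)$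 ($\varphi$ modulo $4K(k)$); - on $C_2$: $k=\sqrt{2/(E+1)}\in(0,1)$, $\sin\frac\gamma2=s_2\mathrm{sn}(\frac\varphi k,k)$, $\cos\frac\gamma2=\mathrm{cn}(\frac\varphi k,k)$, $\frac c2=\frac{s_2}{k}\mathrm{dn}(\frac\varphi k,k)$ ($\varphi$ modulo $4kK(k)$); - on $C_3$: $k=1$, $\sin\frac\gamma2=s_1s_2\tanh\varphi$, $\cos\frac\gamma2=s_1/\cosh\varphi$, $\frac c2=s_2/\cosh\varphi$ ($\varphi\in\mathbb{R}$). Here $\mathrm{sn},\mathrm{cn},\mathrm{dn}$ are Jacobi elliptic functions with modulus $k$ and $K(k)$ is the complete elliptic integral of the first kind. With $\varphi_t=\varphi+t$, set $\tau=\frac12(\varphi_t+\varphi)$ if $\nu=(\lambda,t)\in N_1\cup N_3$, and $\tau=\frac1{2k}(\varphi_t+\varphi)$ if $\nu\in N_2$; $\mathrm{sn}\,\tau=\mathrm{sn}(\tau,k)$, $\mathrm{cn}\,\tau=\mathrm{cn}(\tau,k)$. Reflections: for $\nu=(\lambda,t)=(\gamma,c,t)\in N$, with $(\gamma_t,c_t)$ the pendulum solution at time $t$, set $\lambda^1=(\gamma_t,-c_t)$, $\lambda^2=(-\gamma_t,c_t)$, $\lambda^6=(-\gamma_t+2\pi,c_t)$ (first components in $\mathbb{R}/4\pi\mathbb{Z}$). Maxwell sets: for $i=1,2,6$, $$MAX^i=\{\nu=(\lambda,t)\in N : \lambda\neq\lambda^i,\ Exp(\lambda,t)=Exp(\lambda^i,t)\}.$$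 *)

theory Defs
  imports "HOL-Analysis.Analysis"
begin

lemma equivp_mod_4pi: "equivp (\<lambda>a b :: real. \<exists>n::int. a - b = 4 * pi * of_int n)"
proof (rule equivpI)
  show "reflp (\<lambda>a b :: real. \<exists>n::int. a - b = 4 * pi * of_int n)"
    by (rule reflpI) (auto intro: exI[of _ 0])
  show "symp (\<lambda>a b :: real. \<exists>n::int. a - b = 4 * pi * of_int n)"
  proof (rule sympI)
    fix a b :: real assume "\<exists>n::int. a - b = 4 * pi * of_int n"
    then obtain n :: int where "a - b = 4 * pi * of_int n" ..
    then show "\<exists>n::int. b - a = 4 * pi * of_int n"
      by (intro exI[of _ "- n"]) (simp add: algebra_simps)
  qed
  show "transp (\<lambda>a b :: real. \<exists>n::int. a - b = 4 * pi * of_int n)"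
  proof (rule transpI)
    fix a b c :: real
    assume "\<exists>n::int. a - b = 4 * pi * of_int n" "\<exists>n::int. b - c = 4 * pi * of_int n"
    then obtain n m :: int where "a - b = 4 * pi * of_int n" "b - c = 4 * pi * of_int m" by blast
    then show "\<exists>n::int. a - c = 4 * pi * of_int n"
      by (intro exI[of _ "n + m"]) (simp add: algebra_simps)
  qed
qed

text \<open>The circle of length \<open>4\<pi>\<close> (the reals modulo \<open>4\<pi>\<int>\<close>);
  \<open>angle\<close> is the projection, and the group operations are the induced ones.\<close>

quotient_type angle4pi = real / "\<lambda>a b :: real. \<exists>n::int. a - b = 4 * pi * of_int n"
  by (rule equivp_mod_4pi)

lift_definition angle :: "real \<Rightarrow> angle4pi" is "\<lambda>a. a" .

instantiation angle4pi :: ab_group_add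
begin

lift_definition zero_angle4pi :: angle4pi is "0 :: real" .

lift_definition plus_angle4pi :: "angle4pi \<Rightarrow> angle4pi \<Rightarrow> angle4pi" is "\<lambda>a b. a + b"
proof -
  fix a a' b b' :: real
  assume "\<exists>n::int. a - a' = 4 * pi * of_int n" "\<exists>n::int. b - b' = 4 * pi * of_int n"
  then obtain n m :: int where "a - a' = 4 * pi * of_int n" "b - b' = 4 * pi * of_int m" by blast
  then show "\<exists>n::int. a + b - (a' + b') = 4 * pi * of_int n"
    by (intro exI[of _ "n + m"]) (simp add: algebra_simps)
qed

lift_definition uminus_angle4pi :: "angle4pi \<Rightarrow> angle4pi" is "\<lambda>a. - a"
proof -
  fix a a' :: real
  assume "\<exists>n::int. a - a' = 4 * pi * of_int n"
  then obtain n :: int where "a - a' = 4 * pi * of_int n" ..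
  then show "\<exists>n::int. - a - - a' = 4 * pi * of_int n"
    by (intro exI[of _ "- n"]) (simp add: algebra_simps)
qed

definition minus_angle4pi :: "angle4pi \<Rightarrow> angle4pi \<Rightarrow> angle4pi" where
  "minus_angle4pi a b = a + - b"

instance
proof
  fix a b c :: angle4pi
  show "a + b + c = a + (b + c)" by transfer (rule exI[of _ 0], simp)
  show "a + b = b + a" by transfer (rule exI[of _ 0], simp)
  show "0 + a = a" by transfer (rule exI[of _ 0], simp)
  show "- a + a = 0" by transfer (rule exI[of _ 0], simp)
  show "a - b = a + - b" by (rule minus_angle4pi_def)
qed

end

lemma sin_cos_shift_int:
  fixes x :: real and n :: int
  shows "sin (x + 2 * pi * of_int n) = sin x" "cos (x + 2 * pi * of_int n) = cos x"
  by (simp_all add: sin_add cos_add)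

lift_definition cos_angle :: "angle4pi \<Rightarrow> real" is "\<lambda>a. cos a"
proof -
  fix a b :: real
  assume "\<exists>n::int. a - b = 4 * pi * of_int n"
  then obtain n :: int where "a - b = 4 * pi * of_int n" ..
  then have "a = b + 2 * pi * of_int (2 * n)" by (simp add: algebra_simps)
  then show "cos a = cos b" by (simp only: sin_cos_shift_int)
qed

lift_definition sin_half :: "angle4pi \<Rightarrow> real" is "\<lambda>a. sin (a / 2)"
proof -
  fix a b :: real
  assume "\<exists>n::int. a - b = 4 * pi * of_int n"
  then obtain n :: int where "a - b = 4 * pi * of_int n" ..
  then have "a / 2 = b / 2 + 2 * pi * of_int n" by (simp add: field_simps)
  then show "sin (a / 2) = sin (b / 2)" by (simp only: sin_cos_shift_int)
qed

lift_definition cos_half :: "angle4pi \<Rightarrow> real" is "\<lambda>a. cos (a / 2)"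
proof -
  fix a b :: real
  assume "\<exists>n::int. a - b = 4 * pi * of_int n"
  then obtain n :: int where "a - b = 4 * pi * of_int n" ..
  then have "a / 2 = b / 2 + 2 * pi * of_int n" by (simp add: field_simps)
  then show "cos (a / 2) = cos (b / 2)" by (simp only: sin_cos_shift_int)
qed

type_synonym phase = "angle4pi \<times> real"

definition N :: "(phase \<times> real) set" where
  "N = UNIV \<times> {0<..}"

definition energy :: "phase \<Rightarrow> real" where
  "energy l = (snd l)\<^sup>2 / 2 - cos_angle (fst l)"

definition C1 :: "phase set" where
  "C1 = {l. -1 < energy l \<and> energy l < 1}"

definition C2 :: "phase set" where
  "C2 = {l. 1 < energy l}"

definition C3 :: "phase set" where
  "C3 = {l. energy l = 1 \<and> snd l \<noteq> 0}"

definition N1 :: "(phase \<times> real) set" where "N1 = C1 \<times> {0<..}"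
definition N2 :: "(phase \<times> real) set" where "N2 = C2 \<times> {0<..}"
definition N3 :: "(phase \<times> real) set" where "N3 = C3 \<times> {0<..}"

text \<open>The pendulum component of an extremal is a curve on the cylinder; it is represented by a
  continuous lift \<open>g\<close> of its angle to the real line. Two lifts differ by a constant multiple
  of \<open>4\<pi>\<close>, so \<open>pendulum\<close> and \<open>Exp\<close> do not depend on the lift.
  The vector field is complete, so solutions are taken on the whole real line.\<close>

definition extremal_from ::
  "phase \<Rightarrow> (real \<Rightarrow> real) \<Rightarrow> (real \<Rightarrow> real) \<Rightarrow>
    (real \<Rightarrow> real) \<Rightarrow> (real \<Rightarrow> real) \<Rightarrow> (real \<Rightarrow> real) \<Rightarrow> bool" where
  "extremal_from l g c x y z \<longleftrightarrow>
     (\<forall>s. (g has_real_derivative c s) (at s) \<and>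
          (c has_real_derivative - sin (g s)) (at s) \<and>
          (x has_real_derivative cos (g s / 2) * cosh (z s)) (at s) \<and>
          (y has_real_derivative cos (g s / 2) * sinh (z s)) (at s) \<and>
          (z has_real_derivative sin (g s / 2)) (at s)) \<and>
     (angle (g 0), c 0) = l \<and> x 0 = 0 \<and> y 0 = 0 \<and> z 0 = 0"

definition pendulum :: "phase \<Rightarrow> real \<Rightarrow> phase" where
  "pendulum l t =
     (THE m. \<exists>g c x y z. extremal_from l g c x y z \<and> m = (angle (g t), c t))"

definition Exp :: "phase \<times> real \<Rightarrow> real \<times> real \<times> real" where
  "Exp \<nu> = (THE q. \<exists>g c x y z. extremal_from (fst \<nu>) g c x y z \<and>
               q = (x (snd \<nu>), y (snd \<nu>), z (snd \<nu>)))"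

definition ellint_F :: "real \<Rightarrow> real \<Rightarrow> real" where
  "ellint_F \<theta> k = (LBINT \<psi>=0..\<theta>. 1 / sqrt (1 - k\<^sup>2 * (sin \<psi>)\<^sup>2))"

text \<open>For \<open>0 \<le> k < 1\<close> the incomplete integral \<open>ellint_F\<close> is an increasing bijection of the reals and
  \<open>am\<close> is its inverse; at \<open>k = 1\<close> (the case \<open>C3\<close>) \<open>am\<close>, \<open>sn\<close>, \<open>cn\<close>, \<open>dn\<close> are not used.\<close>

definition am :: "real \<Rightarrow> real \<Rightarrow> real" where
  "am u k = (THE \<theta>. ellint_F \<theta> k = u)"

definition sn :: "real \<Rightarrow> real \<Rightarrow> real" where
  "sn u k = sin (am u k)"

definition cn :: "real \<Rightarrow> real \<Rightarrow> real" where
  "cn u k = cos (am u k)"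

definition dn :: "real \<Rightarrow> real \<Rightarrow> real" where
  "dn u k = sqrt (1 - k\<^sup>2 * (sn u k)\<^sup>2)"

text \<open>On \<open>C1\<close> and \<open>C2\<close> the first elliptic coordinate is only determined modulo a period
  (\<open>4 K(k)\<close> on \<open>C1\<close>, \<open>4 k K(k)\<close> on \<open>C2\<close>): the predicate holds for every real
  representative \<open>\<phi>\<close>.\<close>

definition elliptic_coords :: "phase \<Rightarrow> real \<Rightarrow> real \<Rightarrow> bool" where
  "elliptic_coords l \<phi> k \<longleftrightarrow>
    (let s1 = sgn (cos_half (fst l)); s2 = sgn (snd l) in
      (l \<in> C1 \<and> k = sqrt ((energy l + 1) / 2) \<and>
        sin_half (fst l) = s1 * k * sn \<phi> k \<and>
        cos_half (fst l) = s1 * dn \<phi> k \<and>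
        snd l / 2 = k * cn \<phi> k) \<or>
      (l \<in> C2 \<and> k = sqrt (2 / (energy l + 1)) \<and>
        sin_half (fst l) = s2 * sn (\<phi> / k) k \<and>
        cos_half (fst l) = cn (\<phi> / k) k \<and>
        snd l / 2 = s2 / k * dn (\<phi> / k) k) \<or>
      (l \<in> C3 \<and> k = 1 \<and>
        sin_half (fst l) = s1 * s2 * tanh \<phi> \<and>
        cos_half (fst l) = s1 / cosh \<phi> \<and>
        snd l / 2 = s2 / cosh \<phi>))"

lemma am_ellint_F:
  assumes "0 \<le> k" "k < 1"
  shows "am (ellint_F \<theta> k) k = \<theta>"
proof -
  let ?f = "\<lambda>\<psi>. 1 / sqrt (1 - k\<^sup>2 * (sin \<psi>)\<^sup>2)"
  have pos: "0 < 1 - k\<^sup>2 * (sin \<psi>)\<^sup>2" for \<psi> :: real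
  proof -
    have "k\<^sup>2 < 1" using assms by (simp add: abs_square_less_1)
    moreover have "k\<^sup>2 * (sin \<psi>)\<^sup>2 \<le> k\<^sup>2 * 1"
      by (intro mult_left_mono) (simp_all add: abs_square_le_1)
    ultimately show ?thesis by linarith
  qed
  have cont: "continuous_on A ?f" for A :: "real set"
    using pos by (intro continuous_intros) (simp add: less_imp_neq[symmetric])
  have deriv: "((\<lambda>\<theta>. ellint_F \<theta> k) has_real_derivative ?f u) (at u)" for u :: real
  proof -
    let ?a = "- \<bar>u\<bar> - 1" and ?b = "\<bar>u\<bar> + 1"
    have "((\<lambda>u. LBINT y=0..u. ?f y) has_vector_derivative ?f u) (at u within {?a..?b})"
      using interval_integral_FTC2[of ?a 0 ?b ?f u] cont by (simp add: zero_ereal_def)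
    moreover have "at u within {?a..?b} = at u"
      by (rule at_within_interior) (auto simp: interior_atLeastAtMost_real)
    ultimately show ?thesis
      by (simp add: ellint_F_def has_real_derivative_iff_has_vector_derivative)
  qed
  have mono: "ellint_F a k < ellint_F b k" if "a < b" for a b :: real
    using that by (rule DERIV_pos_imp_increasing) (use deriv pos in fastforce)
  show ?thesis
    unfolding am_def
    by (rule the_equality) (use mono in \<open>metis less_irrefl linorder_neqE\<close>)+
qed

lemma cyl_trig:
  "(sin_half a)\<^sup>2 + (cos_half a)\<^sup>2 = 1" "cos_angle a = 1 - 2 * (sin_half a)\<^sup>2"
  by (transfer, simp) (transfer, simp add: cos_double_sin[symmetric])

lemma elliptic_coords_exist:
  assumes "l \<in> C1 \<union> C2 \<union> C3"
  shows "\<exists>\<phi> k. elliptic_coords l \<phi> k"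
proof -
  define S C h where "S = sin_half (fst l)" and "C = cos_half (fst l)" and "h = snd l / 2"
  have SC: "S\<^sup>2 + C\<^sup>2 = 1" by (simp add: S_def C_def cyl_trig)
  have E: "energy l = 2 * h\<^sup>2 + 2 * S\<^sup>2 - 1"
    by (simp add: energy_def cyl_trig S_def h_def power2_eq_square)
  have sq: "s * (s * w) = w" "(s * w)\<^sup>2 = w\<^sup>2" if "s = 1 \<or> s = -1" for s w :: real
    using that by auto
  have sabs: "sgn w * \<bar>w\<bar> = w" for w :: real by (simp add: sgn_if abs_if)
  consider "l \<in> C1" | "l \<in> C2" | "l \<in> C3" using assms by blast
  then show ?thesis
  proof cases
    case 1
    define k where "k = sqrt ((energy l + 1) / 2)"
    have e: "-1 < energy l" "energy l < 1" using 1 by (auto simp: C1_def)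
    have k: "0 < k" "k < 1" using e by (auto simp: k_def)
    have k2: "k\<^sup>2 = h\<^sup>2 + S\<^sup>2" using e by (simp add: k_def E)
    have "C \<noteq> 0"
    proof
      assume "C = 0"
      then have "S\<^sup>2 = 1" using SC by simp
      then show False using E e zero_le_power2[of h] by linarith
    qed
    then have s1: "sgn C = 1 \<or> sgn C = -1" by (simp add: sgn_if)
    have "(h / k)\<^sup>2 + (sgn C * S / k)\<^sup>2 = 1"
    proof -
      have "(h / k)\<^sup>2 + (sgn C * S / k)\<^sup>2 = (h\<^sup>2 + S\<^sup>2) / k\<^sup>2"
        by (simp add: power_divide sq(2)[OF s1] add_divide_distrib)
      also have "\<dots> = 1" unfolding k2[symmetric] using k by simp
      finally show ?thesis .
    qed
    then obtain \<theta> where \<theta>: "h / k = cos \<theta>" "sgn C * S / k = sin \<theta>"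
      using sincos_total_2pi by metis
    let ?\<phi> = "ellint_F \<theta> k"
    have am: "am ?\<phi> k = \<theta>" using am_ellint_F k by simp
    have "k * sin \<theta> = sgn C * S" using \<theta> k by (simp add: field_simps)
    then have 2: "S = sgn C * k * sin \<theta>" using sq(1)[OF s1, of S] by (simp add: mult.assoc)
    then have "S\<^sup>2 = (k * sin \<theta>)\<^sup>2" by (simp add: sq(2)[OF s1] mult.assoc)
    then have "1 - k\<^sup>2 * (sin \<theta>)\<^sup>2 = C\<^sup>2" using SC by (simp add: power_mult_distrib)
    then have "C = sgn C * sqrt (1 - k\<^sup>2 * (sin \<theta>)\<^sup>2)" by (simp add: sabs)
    moreover have "h = k * cos \<theta>" using \<theta> k by (simp add: field_simps)
    ultimately have "elliptic_coords l ?\<phi> k"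
      using 1 2 by (simp add: elliptic_coords_def Let_def sn_def cn_def dn_def am k_def[symmetric]
          S_def C_def h_def)
    then show ?thesis by blast
  next
    case 2
    define k where "k = sqrt (2 / (energy l + 1))"
    have e: "1 < energy l" using 2 by (auto simp: C2_def)
    have k: "0 < k" "k < 1" using e by (auto simp: k_def)
    have k2: "1 / k\<^sup>2 = h\<^sup>2 + S\<^sup>2" using e by (simp add: k_def E)
    have "h \<noteq> 0"
    proof
      assume "h = 0"
      then show False using E e SC zero_le_power2[of C] by simp
    qed
    then have s2: "sgn h = 1 \<or> sgn h = -1" by (simp add: sgn_if)
    have "C\<^sup>2 + (sgn h * S)\<^sup>2 = 1" using SC by (simp add: sq(2)[OF s2])
    then obtain \<theta> where \<theta>: "C = cos \<theta>" "sgn h * S = sin \<theta>"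
      using sincos_total_2pi by metis
    let ?\<phi> = "k * ellint_F \<theta> k"
    have am: "am (?\<phi> / k) k = \<theta>" using am_ellint_F k by simp
    have S: "S = sgn h * sin \<theta>" using sq(1)[OF s2, of S] \<theta> by simp
    then have "S\<^sup>2 = (sin \<theta>)\<^sup>2" by (simp add: sq(2)[OF s2])
    then have "1 - k\<^sup>2 * (sin \<theta>)\<^sup>2 = (k * h)\<^sup>2"
      using k2 k by (simp add: field_simps power_mult_distrib)
    then have "sqrt (1 - k\<^sup>2 * (sin \<theta>)\<^sup>2) = k * \<bar>h\<bar>"
      using k by (simp add: abs_mult)
    then have "h = sgn h / k * sqrt (1 - k\<^sup>2 * (sin \<theta>)\<^sup>2)" using k by (simp add: sabs)
    moreover have "sgn h = sgn (snd l)" by (simp add: h_def sgn_if)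
    ultimately have "elliptic_coords l ?\<phi> k"
      using 2 S \<theta> k am by (simp add: elliptic_coords_def Let_def sn_def cn_def dn_def
          k_def[symmetric] S_def C_def h_def)
    then show ?thesis by blast
  next
    case 3
    have e: "energy l = 1" and h: "h \<noteq> 0" using 3 by (auto simp: C3_def h_def)
    have hC: "h\<^sup>2 = C\<^sup>2" using e E SC by simp
    then have C: "C \<noteq> 0" using h by auto
    have s1: "sgn C = 1 \<or> sgn C = -1" and s2: "sgn h = 1 \<or> sgn h = -1"
      using C h by (simp_all add: sgn_if)
    let ?\<phi> = "arsinh (sgn C * sgn h * S / \<bar>C\<bar>)"
    have hC': "\<bar>h\<bar> = \<bar>C\<bar>" using hC by (simp add: power2_eq_iff abs_eq_iff)
    have "(cosh ?\<phi>)\<^sup>2 = S\<^sup>2 / C\<^sup>2 + 1"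
      by (simp add: cosh_square_eq power_divide mult.assoc sq(2)[OF s1] sq(2)[OF s2])
    also have "\<dots> = (1 / \<bar>C\<bar>)\<^sup>2" using SC C by (simp add: field_simps power_divide)
    finally have ch: "cosh ?\<phi> = 1 / \<bar>C\<bar>"
      by (rule power2_eq_imp_eq) simp_all
    have t: "tanh ?\<phi> = sgn C * sgn h * S" using C by (simp add: tanh_def ch)
    have "1 / cosh ?\<phi> = \<bar>C\<bar>" "1 / cosh ?\<phi> = \<bar>h\<bar>" using ch hC' by simp_all
    then have "C = sgn C / cosh ?\<phi>" "h = sgn h / cosh ?\<phi>"
      using sabs[of C] sabs[of h] by (simp_all add: divide_inverse)
    moreover have "S = sgn C * sgn h * tanh ?\<phi>"
      using s1 s2 t by auto
    moreover have "sgn h = sgn (snd l)" by (simp add: h_def sgn_if)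
    ultimately have "elliptic_coords l ?\<phi> 1"
      using 3 by (simp add: elliptic_coords_def Let_def S_def C_def h_def)
    then show ?thesis by blast
  qed
qed

definition tau :: "phase \<Rightarrow> real \<Rightarrow> real \<Rightarrow> real \<Rightarrow> real" where
  "tau l \<phi> k t =
    (let \<phi>t = \<phi> + t in
      if l \<in> C2 then 1 / (2 * k) * (\<phi>t + \<phi>) else 1 / 2 * (\<phi>t + \<phi>))"

definition refl1 :: "phase \<times> real \<Rightarrow> phase" where
  "refl1 \<nu> = (case pendulum (fst \<nu>) (snd \<nu>) of (gt, ct) \<Rightarrow> (gt, - ct))"

definition refl2 :: "phase \<times> real \<Rightarrow> phase" where
  "refl2 \<nu> = (case pendulum (fst \<nu>) (snd \<nu>) of (gt, ct) \<Rightarrow> (- gt, ct))"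

definition refl6 :: "phase \<times> real \<Rightarrow> phase" where
  "refl6 \<nu> = (case pendulum (fst \<nu>) (snd \<nu>) of (gt, ct) \<Rightarrow> (- gt + angle (2 * pi), ct))"

definition maxwell_set :: "(phase \<times> real \<Rightarrow> phase) \<Rightarrow> (phase \<times> real) set" where
  "maxwell_set r = {(l, t) \<in> N. l \<noteq> r (l, t) \<and> Exp (l, t) = Exp (r (l, t), t)}"

definition MAX1 :: "(phase \<times> real) set" where "MAX1 = maxwell_set refl1"
definition MAX2 :: "(phase \<times> real) set" where "MAX2 = maxwell_set refl2"
definition MAX6 :: "(phase \<times> real) set" where "MAX6 = maxwell_set refl6"

fun R1 :: "real \<times> real \<times> real \<Rightarrow> real" where
  "R1 (x, y, z) = y * cosh (z / 2) - x * sinh (z / 2)"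

fun R2 :: "real \<times> real \<times> real \<Rightarrow> real" where
  "R2 (x, y, z) = x * cosh (z / 2) - y * sinh (z / 2)"

end

theory Submission
  imports Defs
begin

text \<open>
  Each reflection runs the pendulum backwards from time \<open>t\<close> and possibly flips signs, so the
  reflected extremal is known in closed form in terms of the original one
  (\<open>extremal_reverse\<close>). Its endpoint is an explicit image of the original endpoint
  \<open>(x, y, z)\<close>, involving \<open>cosh z\<close> and \<open>sinh z\<close>. The second reflection sends \<open>z\<close> to \<open>- z\<close>.
  The other two preserve \<open>z\<close>, and passing to the argument \<open>z / 2\<close> the changes of \<open>x\<close> and \<open>y\<close>
  turn out to be \<open>\<plusminus> 2 * R1\<close> (or \<open>\<plusminus> 2 * R2\<close>) times \<open>sinh (z / 2)\<close> and \<open>cosh (z / 2)\<close>, of which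
  the latter never vanishes. Hence the endpoints agree exactly on
  \<open>R1 = 0\<close>, \<open>z = 0\<close> and \<open>R2 = 0\<close> respectively, for extremals of every energy
  (\<open>maxwell_extremal\<close>).

  What remains is to recognise when the covector itself is fixed by the reflection. The functions
  \<open>S = sin (\<gamma> / 2)\<close>, \<open>C = cos (\<gamma> / 2)\<close>, \<open>h = c / 2\<close> determine the point of the cylinder
  and solve the polynomial system \<open>S' = C h\<close>, \<open>C' = - S h\<close>, \<open>h' = - S C\<close>. In elliptic
  coordinates they are, up to order, signs and factors of \<open>k\<close>, the functions \<open>sn\<close>, \<open>dn\<close>, \<open>cn\<close>
  of the time-shifted coordinate (or \<open>tanh\<close> and \<open>1 / cosh\<close> on the separatrix), as
  differentiation shows. Being fixed therefore means that \<open>(sn, cn)\<close> at the two end times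
  agree up to one sign, which happens precisely when \<open>cn\<close> or \<open>sn\<close> vanishes at the midpoint
  \<open>\<tau>\<close> (\<open>midpoint_zero_iff\<close>); it is impossible when it would require the positive function
  \<open>dn\<close> or \<open>1 / cosh\<close> to change sign.

  Because \<open>pendulum\<close> and \<open>Exp\<close> are definite descriptions, both existence and uniqueness of
  extremals enter: uniqueness comes from a Gronwall estimate, and existence from integrating a
  given solution \<open>(S, C, h)\<close> (\<open>extremal_of_half_angle_flow\<close>).
\<close>

section \<open>The angle circle\<close>

lemma angle_eq_iff_half:
  "a = b \<longleftrightarrow> sin_half a = sin_half b \<and> cos_half a = cos_half b"
proof (transfer, safe)
  fix a b :: real and n :: int
  assume "a - b = 4 * pi * of_int n"
  then have *: "a / 2 = b / 2 + 2 * pi * of_int n" by (simp add: field_simps)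
  show "sin (a / 2) = sin (b / 2)" "cos (a / 2) = cos (b / 2)"
    unfolding * by (simp_all only: sin_cos_shift_int)
next
  fix a b :: real
  assume "sin (a / 2) = sin (b / 2)" "cos (a / 2) = cos (b / 2)"
  then have "cos (a / 2 - b / 2) = 1"
    using sin_cos_squared_add[of "b / 2"] by (simp add: cos_diff power2_eq_square)
  then obtain n :: int where "a / 2 - b / 2 = of_int n * 2 * pi"
    using cos_one_2pi_int by blast
  then show "\<exists>n::int. a - b = 4 * pi * of_int n"
    by (intro exI[of _ n]) (simp add: field_simps)
qed

lemma half_angle_simps [simp]:
  "sin_half (angle a) = sin (a / 2)" "cos_half (angle a) = cos (a / 2)"
  "sin_half (- \<alpha>) = - sin_half \<alpha>" "cos_half (- \<alpha>) = cos_half \<alpha>"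
  "sin_half (\<alpha> + angle (2 * pi)) = - sin_half \<alpha>"
  "cos_half (\<alpha> + angle (2 * pi)) = - cos_half \<alpha>"
  by (transfer, simp add: add_divide_distrib)+

lemma angle_group: "- angle a = angle (- a)" "angle a + angle b = angle (a + b)"
  by (transfer, rule exI[of _ 0], simp)+

lemma angle_eq_iff: "angle a = angle b \<longleftrightarrow> (\<exists>n::int. a - b = 4 * pi * of_int n)"
  by transfer simp

lemma angle_surj: "\<exists>a. angle a = \<alpha>"
proof transfer
  fix \<alpha> :: real show "\<exists>a. \<exists>n::int. a - \<alpha> = 4 * pi * of_int n"
    by (intro exI[of _ \<alpha>] exI[of _ 0]) simp
qed

section \<open>Uniqueness of extremals\<close>

lemma DERIV_eq_imp_eq:
  fixes f g :: "real \<Rightarrow> real"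
  assumes "\<And>s. (f has_real_derivative d s) (at s)" "\<And>s. (g has_real_derivative d s) (at s)"
    and "f a = g a"
  shows "f s = g s"
proof -
  have "((\<lambda>s. f s - g s) has_real_derivative 0) (at s)" for s
    using DERIV_diff[OF assms(1,2), of s] by simp
  then have "f s - g s = f a - g a" by (intro DERIV_isconst_all) auto
  then show ?thesis using assms(3) by simp
qed

text \<open>The weighted functions \<open>exp (- L * s) * f s\<close> for \<open>s \<ge> 0\<close> and \<open>exp (L * s) * f s\<close> for
  \<open>s \<le> 0\<close> cannot grow away from \<open>0\<close>.\<close>

lemma gronwall_zero:
  fixes f f' :: "real \<Rightarrow> real"
  assumes f: "\<And>s. (f has_real_derivative f' s) (at s)"
    and bound: "\<And>s. \<bar>f' s\<bar> \<le> L * f s" and nonneg: "\<And>s. 0 \<le> f s" and "f 0 = 0"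
  shows "f s = 0"
proof (cases "0 \<le> s")
  case True
  have "exp (- L * s) * f s \<le> exp (- L * 0) * f 0"
  proof (rule DERIV_nonpos_imp_nonincreasing[OF True])
    fix u
    have "((\<lambda>s. exp (- L * s) * f s) has_real_derivative exp (- L * u) * (f' u - L * f u)) (at u)"
      by (auto intro!: derivative_eq_intros f simp: algebra_simps)
    moreover have "exp (- L * u) * (f' u - L * f u) \<le> 0"
      using bound[of u] by (intro mult_nonneg_nonpos) auto
    ultimately show "\<exists>y. ((\<lambda>s. exp (- L * s) * f s) has_real_derivative y) (at u) \<and> y \<le> 0"
      by blast
  qed
  then have "f s \<le> 0" using \<open>f 0 = 0\<close> by (simp add: mult_le_0_iff)
  then show ?thesis using nonneg[of s] by simp
next
  case False
  then have le: "s \<le> 0" by simp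
  have "exp (L * s) * f s \<le> exp (L * 0) * f 0"
  proof (rule DERIV_nonneg_imp_nondecreasing[OF le])
    fix u
    have "((\<lambda>s. exp (L * s) * f s) has_real_derivative exp (L * u) * (f' u + L * f u)) (at u)"
      by (auto intro!: derivative_eq_intros f simp: algebra_simps)
    moreover have "0 \<le> exp (L * u) * (f' u + L * f u)"
      using bound[of u] by (intro mult_nonneg_nonneg) auto
    ultimately show "\<exists>y. ((\<lambda>s. exp (L * s) * f s) has_real_derivative y) (at u) \<and> 0 \<le> y"
      by blast
  qed
  then have "f s \<le> 0" using \<open>f 0 = 0\<close> by (simp add: mult_le_0_iff)
  then show ?thesis using nonneg[of s] by simp
qed

lemma abs_sin_diff_le: "\<bar>sin a - sin b\<bar> \<le> \<bar>a - b\<bar>" for a b :: real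
proof -
  have "\<bar>sin a - sin b\<bar> = 2 * (\<bar>sin ((a - b) / 2)\<bar> * \<bar>cos ((a + b) / 2)\<bar>)"
    by (simp add: sin_diff_sin abs_mult)
  also have "\<dots> \<le> 2 * (\<bar>(a - b) / 2\<bar> * 1)"
    by (intro mult_left_mono mult_mono abs_sin_x_le_abs_x) auto
  finally show ?thesis by simp
qed

text \<open>The pendulum field is Lipschitz on the whole plane because \<open>sin\<close> is, so the squared distance of
  two solutions satisfies the Gronwall bound with constant \<open>2\<close>.\<close>

lemma pendulum_solution_unique:
  fixes g c g' c' :: "real \<Rightarrow> real"
  assumes "\<And>s. (g has_real_derivative c s) (at s)"
    and "\<And>s. (c has_real_derivative - sin (g s)) (at s)"
    and "\<And>s. (g' has_real_derivative c' s) (at s)"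
    and "\<And>s. (c' has_real_derivative - sin (g' s)) (at s)"
    and "g 0 = g' 0" "c 0 = c' 0"
  shows "g s = g' s" "c s = c' s"
proof -
  let ?D = "\<lambda>s. (g s - g' s)\<^sup>2 + (c s - c' s)\<^sup>2"
  let ?d = "\<lambda>s. 2 * (g s - g' s) * (c s - c' s) - 2 * (c s - c' s) * (sin (g s) - sin (g' s))"
  have "?D s = 0"
  proof (rule gronwall_zero[of ?D ?d 2])
    show "(?D has_real_derivative ?d u) (at u)" for u
      by (auto intro!: derivative_eq_intros assms simp: algebra_simps)
    show "\<bar>?d u\<bar> \<le> 2 * ?D u" for u
    proof -
      let ?p = "\<bar>g u - g' u\<bar>" and ?q = "\<bar>c u - c' u\<bar>"
      have "\<bar>?d u\<bar> \<le> \<bar>2 * (g u - g' u) * (c u - c' u)\<bar>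
          + \<bar>2 * (c u - c' u) * (sin (g u) - sin (g' u))\<bar>"
        by (rule abs_triangle_ineq4)
      also have "\<dots> = 2 * ?p * ?q + 2 * ?q * \<bar>sin (g u) - sin (g' u)\<bar>"
        by (simp only: abs_mult abs_numeral)
      also have "\<dots> \<le> 2 * ?p * ?q + 2 * ?q * ?p"
        by (intro add_left_mono mult_left_mono abs_sin_diff_le) auto
      also have "\<dots> = 2 * (2 * ?p * ?q)" by simp
      also have "\<dots> \<le> 2 * (?p\<^sup>2 + ?q\<^sup>2)"
        by (intro mult_left_mono sum_squares_bound) simp
      finally show ?thesis by simp
    qed
  qed (use assms in auto)
  then show "g s = g' s" "c s = c' s" by (simp_all add: sum_power2_eq_zero_iff)
qed

lemma extremalD:
  assumes "extremal_from l g c x y z"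
  shows "(g has_real_derivative c s) (at s)" "(c has_real_derivative - sin (g s)) (at s)"
    "(x has_real_derivative cos (g s / 2) * cosh (z s)) (at s)"
    "(y has_real_derivative cos (g s / 2) * sinh (z s)) (at s)"
    "(z has_real_derivative sin (g s / 2)) (at s)"
    "l = (angle (g 0), c 0)" "x 0 = 0" "y 0 = 0" "z 0 = 0"
  using assms by (auto simp: extremal_from_def)

text \<open>Two lifts of the same angle start \<open>4\<pi>n\<close> apart. Translating one of them by this amount leaves
  all right-hand sides unchanged, and then the pendulum parts coincide; \<open>z\<close>, \<open>x\<close> and \<open>y\<close> have
  equal derivatives in turn.\<close>

lemma extremal_unique:
  assumes "extremal_from l g c x y z" "extremal_from l g' c' x' y' z'"
  shows "(angle (g s), c s) = (angle (g' s), c' s)" "(x s, y s, z s) = (x' s, y' s, z' s)"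
proof -
  note D = extremalD[OF assms(1)] and D' = extremalD[OF assms(2)]
  have ang: "angle (g 0) = angle (g' 0)" and c0: "c 0 = c' 0" using D(6) D'(6) by auto
  obtain n :: int where n: "g 0 - g' 0 = 4 * pi * of_int n" using ang angle_eq_iff by blast
  have shift: "sin (4 * pi * of_int n + a) = sin a" "sin ((4 * pi * of_int n + a) / 2) = sin (a / 2)"
    "cos ((4 * pi * of_int n + a) / 2) = cos (a / 2)" for a
  proof -
    have "4 * pi * of_int n + a = a + 2 * pi * of_int (2 * n)"
      "(4 * pi * of_int n + a) / 2 = a / 2 + 2 * pi * of_int n"
      by (simp_all add: field_simps)
    then show "sin (4 * pi * of_int n + a) = sin a" "sin ((4 * pi * of_int n + a) / 2) = sin (a / 2)"
      "cos ((4 * pi * of_int n + a) / 2) = cos (a / 2)"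
      by (simp_all only: sin_cos_shift_int)
  qed
  define G where "G = (\<lambda>s. 4 * pi * of_int n + g' s)"
  have G: "(G has_real_derivative c' s) (at s)" for s
    unfolding G_def by (auto intro!: derivative_eq_intros D')
  have c': "(c' has_real_derivative - sin (G s)) (at s)" for s
    using D'(2) by (simp add: G_def shift)
  have G0: "g 0 = G 0" using n by (simp add: G_def)
  have gG: "g s = G s" and c: "c s = c' s" for s
    using pendulum_solution_unique[OF D(1,2) G c' G0 c0] by blast+
  have trig: "sin (g s / 2) = sin (g' s / 2)" "cos (g s / 2) = cos (g' s / 2)" for s
    by (simp_all add: gG G_def shift)
  have z: "z s = z' s" for s
    by (rule DERIV_eq_imp_eq[OF D(5) D'(5)[folded trig], of 0]) (simp add: D D')
  have x: "x s = x' s" for s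
    by (rule DERIV_eq_imp_eq[OF D(3) D'(3)[folded trig z], of 0]) (simp add: D D')
  have y: "y s = y' s" for s
    by (rule DERIV_eq_imp_eq[OF D(4) D'(4)[folded trig z], of 0]) (simp add: D D')
  show "(angle (g s), c s) = (angle (g' s), c' s)" "(x s, y s, z s) = (x' s, y' s, z' s)"
    by (auto simp: gG c x y z angle_eq_iff G_def)
qed

lemma pendulum_extremal:
  assumes "extremal_from l g c x y z"
  shows "pendulum l s = (angle (g s), c s)"
  unfolding pendulum_def
proof (rule the_equality)
  show "\<exists>g' c' x y z. extremal_from l g' c' x y z \<and> (angle (g s), c s) = (angle (g' s), c' s)"
    using assms by blast
  show "m = (angle (g s), c s)"
    if "\<exists>g c x y z. extremal_from l g c x y z \<and> m = (angle (g s), c s)" for m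
    using that extremal_unique(1)[OF _ assms] by metis
qed

lemma Exp_extremal:
  assumes "extremal_from l g c x y z"
  shows "Exp (l, s) = (x s, y s, z s)"
  unfolding Exp_def fst_conv snd_conv
proof (rule the_equality)
  show "\<exists>g c x' y' z'. extremal_from l g c x' y' z' \<and> (x s, y s, z s) = (x' s, y' s, z' s)"
    using assms by blast
  show "q = (x s, y s, z s)"
    if "\<exists>g c x y z. extremal_from l g c x y z \<and> q = (x s, y s, z s)" for q
    using that extremal_unique(2)[OF _ assms] by metis
qed

section \<open>Reflected extremals and their endpoints\<close>

lemma DERIV_reflect:
  fixes f :: "real \<Rightarrow> real"
  assumes "(f has_real_derivative d) (at (t - s))"
  shows "((\<lambda>s. f (t - s)) has_real_derivative - d) (at s)"
proof -
  have "((\<lambda>s. t - s) has_real_derivative - 1) (at s)"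
    by (auto intro!: derivative_eq_intros)
  from DERIV_chain2[OF assms this] show ?thesis by simp
qed

text \<open>A common form of the three reflections. The sign \<open>\<epsilon>\<close> is that of the new angular velocity,
  while \<open>\<delta>\<close> and \<open>\<sigma>\<close> record how the sine and the cosine of the half-angle change. Running the
  curve backwards replaces \<open>z s\<close> by \<open>\<delta> * (z t - z (t - s))\<close>; the addition formulas for \<open>cosh\<close>
  and \<open>sinh\<close> then express the new \<open>x\<close> and \<open>y\<close> linearly in increments of the old ones.\<close>

lemma extremal_reverse:
  fixes \<epsilon> \<delta> \<sigma> :: real
  assumes e: "extremal_from l g c x y z"
    and G: "\<And>s. (G has_real_derivative \<epsilon> * c (t - s)) (at s)"
    and sinG: "\<And>s. sin (G s) = \<epsilon> * - sin (g (t - s))"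
    and sinG2: "\<And>s. sin (G s / 2) = \<delta> * sin (g (t - s) / 2)"
    and cosG2: "\<And>s. cos (G s / 2) = \<sigma> * cos (g (t - s) / 2)"
    and d: "\<delta> = 1 \<or> \<delta> = - 1"
    and l': "l' = (angle (G 0), \<epsilon> * c t)"
  shows "Exp (l', t) = (\<sigma> * (cosh (z t) * x t - sinh (z t) * y t),
           \<sigma> * \<delta> * (sinh (z t) * x t - cosh (z t) * y t), \<delta> * z t)"
proof -
  note D = extremalD[OF e]
  let ?X = "\<lambda>s. \<sigma> * (cosh (z t) * (x t - x (t - s)) - sinh (z t) * (y t - y (t - s)))"
  let ?Y = "\<lambda>s. \<sigma> * \<delta> * (sinh (z t) * (x t - x (t - s)) - cosh (z t) * (y t - y (t - s)))"
  let ?Z = "\<lambda>s. \<delta> * (z t - z (t - s))"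
  have hyp: "cosh (\<delta> * w) = cosh w" "sinh (\<delta> * w) = \<delta> * sinh w" for w
    using d by auto
  have "extremal_from l' G (\<lambda>s. \<epsilon> * c (t - s)) ?X ?Y ?Z"
    unfolding extremal_from_def
  proof (intro conjI allI)
    fix s
    show "(G has_real_derivative \<epsilon> * c (t - s)) (at s)" by (rule G)
    show "((\<lambda>s. \<epsilon> * c (t - s)) has_real_derivative - sin (G s)) (at s)"
      by (rule DERIV_cong[OF DERIV_cmult[OF DERIV_reflect[OF D(2)]]]) (simp add: sinG)
    let ?u = "cos (g (t - s) / 2)" and ?w = "z (t - s)"
    have x: "((\<lambda>s. x t - x (t - s)) has_real_derivative ?u * cosh ?w) (at s)"
      and y: "((\<lambda>s. y t - y (t - s)) has_real_derivative ?u * sinh ?w) (at s)"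
      and z: "((\<lambda>s. z t - z (t - s)) has_real_derivative sin (g (t - s) / 2)) (at s)"
      using DERIV_diff[OF DERIV_const[of "x t"] DERIV_reflect[where t = t and s = s, OF D(3)]]
        DERIV_diff[OF DERIV_const[of "y t"] DERIV_reflect[where t = t and s = s, OF D(4)]]
        DERIV_diff[OF DERIV_const[of "z t"] DERIV_reflect[where t = t and s = s, OF D(5)]]
      by simp_all
    show "(?Z has_real_derivative sin (G s / 2)) (at s)"
      using DERIV_cmult[OF z] by (simp add: sinG2)
    have "cos (G s / 2) * cosh (?Z s)
        = \<sigma> * (cosh (z t) * (?u * cosh ?w) - sinh (z t) * (?u * sinh ?w))"
      unfolding cosG2 hyp cosh_diff by (simp add: algebra_simps)
    then show "(?X has_real_derivative cos (G s / 2) * cosh (?Z s)) (at s)"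
      by (simp only:) (intro DERIV_cmult DERIV_diff x y)
    have "cos (G s / 2) * sinh (?Z s)
        = \<sigma> * \<delta> * (sinh (z t) * (?u * cosh ?w) - cosh (z t) * (?u * sinh ?w))"
      unfolding cosG2 hyp sinh_diff by (simp add: algebra_simps)
    then show "(?Y has_real_derivative cos (G s / 2) * sinh (?Z s)) (at s)"
      by (simp only:) (intro DERIV_cmult DERIV_diff x y)
  qed (auto simp: l')
  from Exp_extremal[OF this, of t] show ?thesis
    using e by (simp add: extremal_from_def)
qed

text \<open>Rewriting with these, the constant \<open>1\<close> included, makes the endpoint conditions homogeneous quadratic in
  \<open>cosh (z / 2)\<close> and \<open>sinh (z / 2)\<close>, which is what exposes the factors \<open>R1\<close> and \<open>R2\<close>.\<close>

lemma cosh_sinh_half: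
  "cosh z = (cosh (z / 2))\<^sup>2 + (sinh (z / 2))\<^sup>2" "sinh z = 2 * sinh (z / 2) * cosh (z / 2)"
  "1 = (cosh (z / 2))\<^sup>2 - (sinh (z / 2))\<^sup>2" for z :: real
  using cosh_double[of "z / 2"] sinh_double[of "z / 2"] cosh_square_eq[of "z / 2"] by simp_all

lemma fixed_reflection1:
  fixes x y z :: real
  shows "(x, y, z) = (cosh z * x - sinh z * y, sinh z * x - cosh z * y, z) \<longleftrightarrow> R1 (x, y, z) = 0"
proof -
  let ?C = "cosh (z / 2)" and ?S = "sinh (z / 2)"
  have 1: "cosh z * x - sinh z * y - x = - 2 * ?S * R1 (x, y, z)"
  proof -
    have "cosh z * x - sinh z * y - 1 * x = (?C\<^sup>2 + ?S\<^sup>2) * x - 2 * ?S * ?C * y - (?C\<^sup>2 - ?S\<^sup>2) * x"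
      by (simp only: cosh_sinh_half[of z])
    then show ?thesis by (simp add: algebra_simps power2_eq_square)
  qed
  have 2: "sinh z * x - cosh z * y - y = - 2 * ?C * R1 (x, y, z)"
  proof -
    have "sinh z * x - cosh z * y - 1 * y = 2 * ?S * ?C * x - (?C\<^sup>2 + ?S\<^sup>2) * y - (?C\<^sup>2 - ?S\<^sup>2) * y"
      by (simp only: cosh_sinh_half[of z])
    then show ?thesis by (simp add: algebra_simps power2_eq_square)
  qed
  have "?C \<noteq> 0" using cosh_real_pos[of "z / 2"] by simp
  moreover have "(x, y, z) = (cosh z * x - sinh z * y, sinh z * x - cosh z * y, z) \<longleftrightarrow>
      cosh z * x - sinh z * y - x = 0 \<and> sinh z * x - cosh z * y - y = 0"
    by auto
  ultimately show ?thesis unfolding 1 2 by (simp del: R1.simps) blast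
qed

lemma fixed_reflection2:
  fixes x y z :: real
  shows "(x, y, z) = (cosh z * x - sinh z * y, - (sinh z * x - cosh z * y), - z) \<longleftrightarrow> z = 0"
  by auto

lemma fixed_reflection6:
  fixes x y z :: real
  shows "(x, y, z) = (- (cosh z * x - sinh z * y), - (sinh z * x - cosh z * y), z)
    \<longleftrightarrow> R2 (x, y, z) = 0"
proof -
  let ?C = "cosh (z / 2)" and ?S = "sinh (z / 2)"
  have 1: "cosh z * x - sinh z * y + x = 2 * ?C * R2 (x, y, z)"
  proof -
    have "cosh z * x - sinh z * y + 1 * x = (?C\<^sup>2 + ?S\<^sup>2) * x - 2 * ?S * ?C * y + (?C\<^sup>2 - ?S\<^sup>2) * x"
      by (simp only: cosh_sinh_half[of z])
    then show ?thesis by (simp add: algebra_simps power2_eq_square)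
  qed
  have 2: "sinh z * x - cosh z * y + y = 2 * ?S * R2 (x, y, z)"
  proof -
    have "sinh z * x - cosh z * y + 1 * y = 2 * ?S * ?C * x - (?C\<^sup>2 + ?S\<^sup>2) * y + (?C\<^sup>2 - ?S\<^sup>2) * y"
      by (simp only: cosh_sinh_half[of z])
    then show ?thesis by (simp add: algebra_simps power2_eq_square)
  qed
  have "?C \<noteq> 0" using cosh_real_pos[of "z / 2"] by simp
  moreover have "(x, y, z) = (- (cosh z * x - sinh z * y), - (sinh z * x - cosh z * y), z) \<longleftrightarrow>
      cosh z * x - sinh z * y + x = 0 \<and> sinh z * x - cosh z * y + y = 0"
    by (simp only: prod.inject) linarith
  ultimately show ?thesis unfolding 1 2 by (simp del: R2.simps) blast
qed

text \<open>The covector of the reflected extremal is written out from the lift \<open>g\<close>, which turns membership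
  in a Maxwell set into a condition on the endpoint together with one on \<open>(g t, c t)\<close>. The lifts
  \<open>g (t - s)\<close>, \<open>- g (t - s)\<close> and \<open>2\<pi> - g (t - s)\<close> realise the three reflections.\<close>

lemma maxwell_extremal:
  assumes e: "extremal_from l g c x y z" and t: "0 < t"
  shows "(l, t) \<in> MAX1 \<longleftrightarrow> l \<noteq> (angle (g t), - c t) \<and> R1 (x t, y t, z t) = 0" (is ?th1)
    and "(l, t) \<in> MAX2 \<longleftrightarrow> l \<noteq> (- angle (g t), c t) \<and> z t = 0" (is ?th2)
    and "(l, t) \<in> MAX6 \<longleftrightarrow> l \<noteq> (- angle (g t) + angle (2 * pi), c t) \<and> R2 (x t, y t, z t) = 0"
      (is ?th6)
proof -
  note D = extremalD[OF e]
  note P = pendulum_extremal[OF e, of t] and E = Exp_extremal[OF e, of t]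
  note rev = DERIV_reflect[OF D(1)]
  have "Exp ((angle (g t), - c t), t) = (1 * (cosh (z t) * x t - sinh (z t) * y t),
           1 * 1 * (sinh (z t) * x t - cosh (z t) * y t), 1 * z t)"
    by (rule extremal_reverse[OF e, where G = "\<lambda>s. g (t - s)" and \<epsilon> = "- 1"]) (auto intro!: rev)
  then show ?th1
    using t fixed_reflection1[of "x t" "y t" "z t"]
    by (simp add: MAX1_def maxwell_set_def N_def refl1_def P E del: R1.simps)
  have "Exp ((- angle (g t), c t), t) = (1 * (cosh (z t) * x t - sinh (z t) * y t),
           1 * (- 1) * (sinh (z t) * x t - cosh (z t) * y t), (- 1) * z t)"
    by (rule extremal_reverse[OF e, where G = "\<lambda>s. - g (t - s)" and \<epsilon> = 1])
      (auto intro!: derivative_eq_intros rev simp: angle_group)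
  then show ?th2
    using t fixed_reflection2[of "x t" "y t" "z t"]
    by (simp add: MAX2_def maxwell_set_def N_def refl2_def P E)
  have "Exp ((- angle (g t) + angle (2 * pi), c t), t)
      = ((- 1) * (cosh (z t) * x t - sinh (z t) * y t),
           (- 1) * 1 * (sinh (z t) * x t - cosh (z t) * y t), 1 * z t)"
    by (rule extremal_reverse[OF e, where G = "\<lambda>s. - g (t - s) + 2 * pi" and \<epsilon> = 1])
      (auto intro!: derivative_eq_intros rev simp: angle_group diff_divide_distrib)
  then show ?th6
    using t fixed_reflection6[of "x t" "y t" "z t"]
    by (simp add: MAX6_def maxwell_set_def N_def refl6_def P E del: R2.simps)
qed

section \<open>Half-angle curves\<close>

text \<open>The pendulum written for \<open>S = sin (\<gamma> / 2)\<close>, \<open>C = cos (\<gamma> / 2)\<close>, \<open>h = c / 2\<close>. In this form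
  there are no lifts of the angle to choose, and the elliptic parametrisations are read off
  directly; \<open>S\<^sup>2 + C\<^sup>2 = 1\<close> follows from the initial condition.\<close>

definition half_angle_flow ::
  "phase \<Rightarrow> (real \<Rightarrow> real) \<Rightarrow> (real \<Rightarrow> real) \<Rightarrow> (real \<Rightarrow> real) \<Rightarrow> bool" where
  "half_angle_flow l S C h \<longleftrightarrow>
     (\<forall>s. (S has_real_derivative C s * h s) (at s) \<and>
          (C has_real_derivative - (S s * h s)) (at s) \<and>
          (h has_real_derivative - (S s * C s)) (at s)) \<and>
     sin_half (fst l) = S 0 \<and> cos_half (fst l) = C 0 \<and> snd l = 2 * h 0"

lemma DERIV_LBINT:
  fixes f :: "real \<Rightarrow> real"
  assumes "\<And>s. isCont f s"
  shows "((\<lambda>u. LBINT y=0..u. f y) has_real_derivative f u) (at u)"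
proof -
  let ?a = "- \<bar>u\<bar> - 1" and ?b = "\<bar>u\<bar> + 1"
  have "((\<lambda>u. LBINT y=0..u. f y) has_vector_derivative f u) (at u within {?a..?b})"
    using interval_integral_FTC2[of ?a 0 ?b f u] assms
    by (simp add: zero_ereal_def continuous_at_imp_continuous_on)
  moreover have "at u within {?a..?b} = at u"
    by (rule at_within_interior) (auto simp: interior_atLeastAtMost_real)
  ultimately show ?thesis by (simp add: has_real_derivative_iff_has_vector_derivative)
qed

lemma global_antiderivative:
  fixes f :: "real \<Rightarrow> real"
  assumes "\<And>s. isCont f s"
  obtains F where "F 0 = a" "\<And>s. (F has_real_derivative f s) (at s)"
proof (rule that[of "\<lambda>u. a + (LBINT y=0..u. f y)"])
  show "a + (LBINT y=0..ereal 0. f y) = a" by (simp add: zero_ereal_def)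
  fix u :: real
  from DERIV_add[OF DERIV_const[of a] DERIV_LBINT[OF assms]]
  show "((\<lambda>u. a + (LBINT y=0..u. f y)) has_real_derivative f u) (at u)" by simp
qed

text \<open>The angle is recovered by integrating \<open>2 * h\<close>. Both \<open>(S, C)\<close> and
  \<open>(sin (g / 2), cos (g / 2))\<close> then rotate with the same angular speed \<open>h\<close>, so their distance is
  constant, and it is zero initially. The remaining coordinates are plain antiderivatives.\<close>

lemma extremal_of_half_angle_flow:
  assumes "half_angle_flow l S C h"
  obtains g c x y z where "extremal_from l g c x y z"
    "\<And>s. sin (g s / 2) = S s" "\<And>s. cos (g s / 2) = C s" "\<And>s. c s = 2 * h s"
proof -
  note f = assms[unfolded half_angle_flow_def, THEN conjunct1, rule_format]
  have S: "(S has_real_derivative C s * h s) (at s)"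
    and C: "(C has_real_derivative - (S s * h s)) (at s)"
    and h: "(h has_real_derivative - (S s * C s)) (at s)" for s using f[of s] by auto
  note init = assms[unfolded half_angle_flow_def, THEN conjunct2]
  obtain g0 where g0: "angle g0 = fst l" using angle_surj by blast
  have "isCont (\<lambda>s. 2 * h s) s" for s using DERIV_isCont[OF h] by (intro continuous_intros)
  then obtain g where g: "g 0 = g0" "\<And>s. (g has_real_derivative 2 * h s) (at s)"
    using global_antiderivative by blast
  have gi: "sin (g 0 / 2) = S 0" "cos (g 0 / 2) = C 0"
    using init by (simp_all add: g(1) flip: g0)
  have "(sin (g s / 2) - S s)\<^sup>2 + (cos (g s / 2) - C s)\<^sup>2 = 0" for s
    by (rule DERIV_eq_imp_eq[where f = "\<lambda>s. (sin (g s / 2) - S s)\<^sup>2 + (cos (g s / 2) - C s)\<^sup>2"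
          and g = "\<lambda>_. 0" and d = "\<lambda>_. 0" and a = 0])
      (auto intro!: derivative_eq_intros g(2) S C simp: gi field_simps)
  then have gS: "sin (g s / 2) = S s" and gC: "cos (g s / 2) = C s" for s
    by (simp_all add: sum_power2_eq_zero_iff)
  have "isCont S s" for s using S DERIV_isCont by blast
  then obtain z where z: "z 0 = 0" "\<And>s. (z has_real_derivative S s) (at s)"
    using global_antiderivative by blast
  have cont: "isCont C s" "isCont z s" for s using C z(2) DERIV_isCont by blast+
  have "isCont (\<lambda>s. C s * cosh (z s)) s" for s by (intro continuous_intros cont)
  then obtain x where x: "x 0 = 0" "\<And>s. (x has_real_derivative C s * cosh (z s)) (at s)"
    using global_antiderivative by blast
  have "isCont (\<lambda>s. C s * sinh (z s)) s" for s by (intro continuous_intros cont)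
  then obtain y where y: "y 0 = 0" "\<And>s. (y has_real_derivative C s * sinh (z s)) (at s)"
    using global_antiderivative by blast
  have "extremal_from l g (\<lambda>s. 2 * h s) x y z"
    unfolding extremal_from_def
  proof (intro conjI allI)
    fix s
    have "sin (g s) = 2 * S s * C s" using sin_double[of "g s / 2"] by (simp add: gS gC)
    then show "((\<lambda>s. 2 * h s) has_real_derivative - sin (g s)) (at s)"
      by (auto intro!: derivative_eq_intros h)
  qed (use g x y z g0 init in \<open>auto simp: gS gC prod_eq_iff\<close>)
  then show ?thesis using that gS gC by blast
qed

lemma maxwell_half_angle:
  assumes f: "half_angle_flow l S C h" and t: "0 < t" and q: "Exp (l, t) = (x, y, z)"
  shows "(l, t) \<in> MAX1 \<longleftrightarrow> R1 (x, y, z) = 0 \<and> \<not> (S t = S 0 \<and> C t = C 0 \<and> h t = - h 0)"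
    and "(l, t) \<in> MAX2 \<longleftrightarrow> z = 0 \<and> \<not> (S t = - S 0 \<and> C t = C 0 \<and> h t = h 0)"
    and "(l, t) \<in> MAX6 \<longleftrightarrow> R2 (x, y, z) = 0 \<and> \<not> (S t = S 0 \<and> C t = - C 0 \<and> h t = h 0)"
proof -
  obtain g c X Y Z where e: "extremal_from l g c X Y Z"
    and g: "\<And>s. sin (g s / 2) = S s" "\<And>s. cos (g s / 2) = C s" "\<And>s. c s = 2 * h s"
    using extremal_of_half_angle_flow[OF f] by metis
  have init: "sin_half (fst l) = S 0" "cos_half (fst l) = C 0" "snd l = 2 * h 0"
    using f by (auto simp: half_angle_flow_def)
  have xyz: "X t = x" "Y t = y" "Z t = z" using q Exp_extremal[OF e, of t] by auto
  note M = maxwell_extremal[OF e t, unfolded xyz]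
  show "(l, t) \<in> MAX1 \<longleftrightarrow> R1 (x, y, z) = 0 \<and> \<not> (S t = S 0 \<and> C t = C 0 \<and> h t = - h 0)"
    unfolding M prod_eq_iff fst_conv snd_conv angle_eq_iff_half[of "fst l"] by (auto simp: g init)
  show "(l, t) \<in> MAX2 \<longleftrightarrow> z = 0 \<and> \<not> (S t = - S 0 \<and> C t = C 0 \<and> h t = h 0)"
    unfolding M prod_eq_iff fst_conv snd_conv angle_eq_iff_half[of "fst l"] by (auto simp: g init)
  show "(l, t) \<in> MAX6 \<longleftrightarrow> R2 (x, y, z) = 0 \<and> \<not> (S t = S 0 \<and> C t = - C 0 \<and> h t = h 0)"
    unfolding M prod_eq_iff fst_conv snd_conv angle_eq_iff_half[of "fst l"] 
    by (auto simp: g init simp del: uminus_add_conv_diff)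
qed

section \<open>Jacobi elliptic functions\<close>

lemma ellint_radicand_pos:
  fixes k :: real
  assumes "0 \<le> k" "k < 1"
  shows "0 < 1 - k\<^sup>2 * (sin \<psi>)\<^sup>2"
proof -
  have "k\<^sup>2 < 1" using assms by (simp add: abs_square_less_1)
  moreover have "k\<^sup>2 * (sin \<psi>)\<^sup>2 \<le> k\<^sup>2 * 1"
    by (intro mult_left_mono) (simp_all add: abs_square_le_1)
  ultimately show ?thesis by linarith
qed

lemma ellint_F_deriv:
  assumes "0 \<le> k" "k < 1"
  shows "((\<lambda>\<theta>. ellint_F \<theta> k) has_real_derivative 1 / sqrt (1 - k\<^sup>2 * (sin \<theta>)\<^sup>2)) (at \<theta>)"
proof -
  have "isCont (\<lambda>\<psi>. 1 / sqrt (1 - k\<^sup>2 * (sin \<psi>)\<^sup>2)) u" for u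
    using ellint_radicand_pos[OF assms, of u] by (intro continuous_intros) simp
  from DERIV_LBINT[OF this] show ?thesis by (simp add: ellint_F_def)
qed

lemma ellint_F_0 [simp]: "ellint_F 0 k = 0"
  by (simp add: ellint_F_def zero_ereal_def)

text \<open>Surjectivity of \<open>ellint_F\<close>: its derivative is at least \<open>1\<close>, so it covers
  \<open>{- \<bar>u\<bar>..\<bar>u\<bar>}\<close> already on that interval.\<close>

lemma ellint_F_am:
  assumes "0 \<le> k" "k < 1"
  shows "ellint_F (am u k) k = u"
proof -
  let ?F = "\<lambda>\<theta>. ellint_F \<theta> k"
  note der = ellint_F_deriv[OF assms]
  have cont: "isCont ?F \<theta>" for \<theta> using der DERIV_isCont by blast
  have slope: "1 \<le> 1 / sqrt (1 - k\<^sup>2 * (sin \<theta>)\<^sup>2)" for \<theta>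
    using ellint_radicand_pos[OF assms, of \<theta>] by (simp add: real_sqrt_le_1_iff)
  have mono: "?F a - a \<le> ?F b - b" if "a \<le> b" for a b
  proof (rule DERIV_nonneg_imp_nondecreasing[OF that])
    fix \<theta>
    have "((\<lambda>\<theta>. ?F \<theta> - \<theta>) has_real_derivative 1 / sqrt (1 - k\<^sup>2 * (sin \<theta>)\<^sup>2) - 1) (at \<theta>)"
      by (intro derivative_intros der)
    then show "\<exists>y. ((\<lambda>\<theta>. ?F \<theta> - \<theta>) has_real_derivative y) (at \<theta>) \<and> 0 \<le> y"
      using slope[of \<theta>] by (metis diff_ge_0_iff_ge)
  qed
  have "\<exists>\<theta>. - \<bar>u\<bar> \<le> \<theta> \<and> \<theta> \<le> \<bar>u\<bar> \<and> ?F \<theta> = u"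
    by (rule IVT) (use mono[of 0 "\<bar>u\<bar>"] mono[of "- \<bar>u\<bar>" 0] cont in auto)
  then show ?thesis using am_ellint_F[OF assms] by metis
qed

lemma dn_pos:
  assumes "0 \<le> k" "k < 1"
  shows "0 < dn u k"
  using ellint_radicand_pos[OF assms] by (simp add: dn_def sn_def)

lemma am_deriv:
  assumes "0 \<le> k" "k < 1"
  shows "((\<lambda>u. am u k) has_real_derivative dn u k) (at u)"
proof -
  let ?F = "\<lambda>\<theta>. ellint_F \<theta> k"
  have Fc: "isCont ?F \<theta>" for \<theta> using ellint_F_deriv[OF assms] DERIV_isCont by blast
  have "isCont (\<lambda>u. am u k) (?F (am u k))"
    by (rule isCont_inverse_function[of 1]) (use am_ellint_F[OF assms] Fc in auto)
  then have c: "isCont (\<lambda>u. am u k) u" by (simp add: ellint_F_am[OF assms])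
  have "((\<lambda>u. am u k) has_real_derivative inverse (1 / dn u k)) (at u)"
  proof (rule DERIV_inverse_function[of ?F _ _ u "u - 1" "u + 1"])
    show "(?F has_real_derivative 1 / dn u k) (at (am u k))"
      using ellint_F_deriv[OF assms] by (simp add: dn_def sn_def)
  qed (use dn_pos[OF assms, of u] ellint_F_am[OF assms] c in auto)
  then show ?thesis by simp
qed

lemma sn_deriv:
  assumes "0 \<le> k" "k < 1"
  shows "((\<lambda>u. sn u k) has_real_derivative cn u k * dn u k) (at u)"
  unfolding sn_def cn_def by (auto intro!: derivative_eq_intros am_deriv[OF assms])

lemma cn_deriv:
  assumes "0 \<le> k" "k < 1"
  shows "((\<lambda>u. cn u k) has_real_derivative - (sn u k * dn u k)) (at u)"
  unfolding sn_def cn_def by (auto intro!: derivative_eq_intros am_deriv[OF assms])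

lemma dn_deriv:
  assumes "0 \<le> k" "k < 1"
  shows "((\<lambda>u. dn u k) has_real_derivative - (k\<^sup>2 * sn u k * cn u k)) (at u)"
proof -
  have "0 < 1 - k\<^sup>2 * (sn u k)\<^sup>2" using ellint_radicand_pos[OF assms] by (simp add: sn_def)
  moreover have "0 < sqrt (1 - k\<^sup>2 * (sn u k)\<^sup>2)" using calculation by simp
  ultimately show ?thesis
    unfolding dn_def
    by (auto intro!: derivative_eq_intros sn_deriv[OF assms] simp: dn_def field_simps)
qed

text \<open>The integrand of \<open>ellint_F\<close> is even about every multiple of \<open>\<pi> / 2\<close>, so \<open>ellint_F\<close> has each
  of these points as a centre of point symmetry. Its inverse \<open>am\<close> inherits the symmetry: a pair of
  arguments whose amplitudes are symmetric about such a point is symmetric about the argument of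
  that point.\<close>

lemma am_sum_eq_iff:
  fixes m :: int
  assumes "0 \<le> k" "k < 1"
  shows "am a k + am b k = of_int m * pi \<longleftrightarrow> am ((a + b) / 2) k = of_int m * pi / 2"
proof -
  let ?F = "\<lambda>\<theta>. ellint_F \<theta> k" and ?c = "of_int m * pi / 2"
  let ?f = "\<lambda>\<theta>. 1 / sqrt (1 - k\<^sup>2 * (sin \<theta>)\<^sup>2)"
  have even: "(sin (?c + \<theta>))\<^sup>2 = (sin (?c - \<theta>))\<^sup>2" for \<theta>
  proof -
    have "(sin (?c + \<theta>))\<^sup>2 - (sin (?c - \<theta>))\<^sup>2 = sin (2 * ?c) * sin (2 * \<theta>)"
      unfolding sin_double by (simp add: sin_add sin_diff power2_eq_square algebra_simps)
    also have "sin (2 * ?c) = 0" by (auto simp: sin_zero_iff_int2)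
    finally show ?thesis by simp
  qed
  have sym: "?F (?c + \<theta>) + ?F (?c - \<theta>) = 2 * ?F ?c" for \<theta>
  proof (rule DERIV_eq_imp_eq[where f = "\<lambda>\<theta>. ?F (?c + \<theta>) + ?F (?c - \<theta>)"
        and g = "\<lambda>_. 2 * ?F ?c" and d = "\<lambda>_. 0" and a = 0])
    fix \<theta>
    have "((\<lambda>\<theta>. ?F (?c + \<theta>)) has_real_derivative ?f (?c + \<theta>) * 1) (at \<theta>)"
      by (rule DERIV_chain2[OF ellint_F_deriv[OF assms]]) (auto intro!: derivative_eq_intros)
    moreover have "((\<lambda>\<theta>. ?F (?c - \<theta>)) has_real_derivative ?f (?c - \<theta>) * - 1) (at \<theta>)"
      by (rule DERIV_chain2[OF ellint_F_deriv[OF assms]]) (auto intro!: derivative_eq_intros)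
    ultimately show "((\<lambda>\<theta>. ?F (?c + \<theta>) + ?F (?c - \<theta>)) has_real_derivative 0) (at \<theta>)"
      using DERIV_add even[of \<theta>] by fastforce
  qed auto
  have F: "?F (am u k) = u" for u by (rule ellint_F_am[OF assms])
  have A: "am (?F \<theta>) k = \<theta>" for \<theta> by (rule am_ellint_F[OF assms])
  have "a + ?F (2 * ?c - am a k) = 2 * ?F ?c"
    using sym[of "am a k - ?c"] by (simp add: F algebra_simps)
  then have "am b k = 2 * ?c - am a k \<longleftrightarrow> a + b = 2 * ?F ?c"
    using F[of b] A[of "2 * ?c - am a k"] by (metis add_left_cancel)
  moreover have "a + b = 2 * ?F ?c \<longleftrightarrow> am ((a + b) / 2) k = ?c"
    using F[of "(a + b) / 2"] A[of ?c] by (metis field_sum_of_halves mult_2 nonzero_mult_div_cancel_left zero_neq_numeral)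
  ultimately show ?thesis by (simp add: algebra_simps)
qed

text \<open>The points \<open>(cos b, sin b)\<close> and \<open>(- cos a, sin a)\<close> of the unit circle are at distance
  \<open>\<bar>2 * cos ((a + b) / 2)\<bar>\<close>, and \<open>(cos b, sin b)\<close> and \<open>(cos a, - sin a)\<close> at distance
  \<open>\<bar>2 * sin ((a + b) / 2)\<bar>\<close>.\<close>

lemma cos_sin_half_sum_zero:
  fixes a b :: real
  shows "cos ((a + b) / 2) = 0 \<longleftrightarrow> sin b = sin a \<and> cos b = - cos a"
    and "sin ((a + b) / 2) = 0 \<longleftrightarrow> sin b = - sin a \<and> cos b = cos a"
proof -
  have one: "(sin a)\<^sup>2 = 1 - (cos a)\<^sup>2" "(sin b)\<^sup>2 = 1 - (cos b)\<^sup>2"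
    by (simp_all add: sin_squared_eq)
  have dbl: "cos (a + b) = 2 * (cos ((a + b) / 2))\<^sup>2 - 1" "cos (a + b) = 1 - 2 * (sin ((a + b) / 2))\<^sup>2"
    using cos_double_cos[of "(a + b) / 2"] cos_double_sin[of "(a + b) / 2"]
    by (simp_all only: mult_2 field_sum_of_halves)
  have "(cos b + cos a)\<^sup>2 + (sin b - sin a)\<^sup>2 = 2 + 2 * cos (a + b)"
    by (simp add: power2_sum power2_diff one) (simp add: cos_add algebra_simps)
  then have "(cos b + cos a)\<^sup>2 + (sin b - sin a)\<^sup>2 = 0 \<longleftrightarrow> cos ((a + b) / 2) = 0"
    by (simp add: dbl(1))
  then show "cos ((a + b) / 2) = 0 \<longleftrightarrow> sin b = sin a \<and> cos b = - cos a"
    unfolding sum_power2_eq_zero_iff by auto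
  have "(cos b - cos a)\<^sup>2 + (sin b + sin a)\<^sup>2 = 2 - 2 * cos (a + b)"
    by (simp add: power2_sum power2_diff one) (simp add: cos_add algebra_simps)
  then have "(cos b - cos a)\<^sup>2 + (sin b + sin a)\<^sup>2 = 0 \<longleftrightarrow> sin ((a + b) / 2) = 0"
    by (simp add: dbl(2))
  then show "sin ((a + b) / 2) = 0 \<longleftrightarrow> sin b = - sin a \<and> cos b = cos a"
    unfolding sum_power2_eq_zero_iff by auto
qed

text \<open>The zeros of \<open>cos\<close> and \<open>sin\<close> are multiples of \<open>\<pi> / 2\<close>, and by \<open>am_sum_eq_iff\<close> the mean of
  two amplitudes is such a multiple exactly when the amplitude of the mean is the same one. So the
  midpoint of the arguments may be replaced by the midpoint of the amplitudes, where the
  trigonometric identity applies.\<close>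

lemma midpoint_zero_iff:
  assumes "0 \<le> k" "k < 1"
  shows "cn ((a + b) / 2) k = 0 \<longleftrightarrow> sn b k = sn a k \<and> cn b k = - cn a k"
    and "sn ((a + b) / 2) k = 0 \<longleftrightarrow> sn b k = - sn a k \<and> cn b k = cn a k"
proof -
  let ?m = "(am a k + am b k) / 2"
  have half: "?m = of_int m * (pi / 2) \<longleftrightarrow> am ((a + b) / 2) k = of_int m * (pi / 2)" for m
    using am_sum_eq_iff[OF assms, of a b m] by auto
  have "cos ?m = 0 \<longleftrightarrow> cos (am ((a + b) / 2) k) = 0"
    unfolding cos_zero_iff_int half ..
  then show "cn ((a + b) / 2) k = 0 \<longleftrightarrow> sn b k = sn a k \<and> cn b k = - cn a k"
    unfolding cn_def sn_def cos_sin_half_sum_zero(1) by simp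
  have "sin ?m = 0 \<longleftrightarrow> sin (am ((a + b) / 2) k) = 0"
    unfolding sin_zero_iff_int half ..
  then show "sn ((a + b) / 2) k = 0 \<longleftrightarrow> sn b k = - sn a k \<and> cn b k = cn a k"
    unfolding cn_def sn_def cos_sin_half_sum_zero(2) by simp
qed

section \<open>The pendulum in elliptic coordinates\<close>

lemma half_angle_energy:
  "energy l = 2 * (snd l / 2)\<^sup>2 + 2 * (sin_half (fst l))\<^sup>2 - 1"
  by (simp add: energy_def cyl_trig power2_eq_square)

text \<open>Along oscillations \<open>cos (\<gamma> / 2)\<close> never vanishes, so its sign \<open>\<sigma>\<close> is a constant of the
  motion.\<close>

lemma elliptic_flow_C1:
  assumes l: "l \<in> C1" and e: "elliptic_coords l \<phi> k"
  obtains \<sigma> where "0 < k" "k < 1" "\<sigma>\<^sup>2 = 1"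
    "half_angle_flow l (\<lambda>s. \<sigma> * k * sn (\<phi> + s) k) (\<lambda>s. \<sigma> * dn (\<phi> + s) k)
       (\<lambda>s. k * cn (\<phi> + s) k)"
proof -
  let ?\<sigma> = "sgn (cos_half (fst l))"
  have E: "- 1 < energy l" "energy l < 1" using l by (auto simp: C1_def)
  have k: "k = sqrt ((energy l + 1) / 2)" and init: "sin_half (fst l) = ?\<sigma> * k * sn \<phi> k"
    "cos_half (fst l) = ?\<sigma> * dn \<phi> k" "snd l / 2 = k * cn \<phi> k"
    using e l by (auto simp: elliptic_coords_def Let_def C1_def C2_def C3_def)
  have k01: "0 < k" "k < 1" using E by (auto simp: k)
  then have D: "((\<lambda>s. f (\<phi> + s)) has_real_derivative d) (at s)"
    if "(f has_real_derivative d) (at (\<phi> + s))" for f d s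
  proof -
    have "((\<lambda>s. \<phi> + s) has_real_derivative 1) (at s)"
      by (auto intro!: derivative_eq_intros)
    from DERIV_chain2[OF that this] show ?thesis by simp
  qed
  have "cos_half (fst l) \<noteq> 0"
  proof
    assume "cos_half (fst l) = 0"
    then have "(sin_half (fst l))\<^sup>2 = 1" using cyl_trig(1)[of "fst l"] by simp
    then show False using E half_angle_energy[of l] zero_le_power2[of "snd l / 2"] by linarith
  qed
  then have \<sigma>: "?\<sigma>\<^sup>2 = 1" by (simp add: sgn_if)
  have k0: "0 \<le> k" using k01 by simp
  note d = D[OF sn_deriv[OF k0 k01(2)]] D[OF cn_deriv[OF k0 k01(2)]] D[OF dn_deriv[OF k0 k01(2)]]
  have "half_angle_flow l (\<lambda>s. ?\<sigma> * k * sn (\<phi> + s) k) (\<lambda>s. ?\<sigma> * dn (\<phi> + s) k)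
       (\<lambda>s. k * cn (\<phi> + s) k)"
    unfolding half_angle_flow_def
  proof (intro conjI allI)
    fix s
    show "((\<lambda>s. ?\<sigma> * k * sn (\<phi> + s) k) has_real_derivative
        ?\<sigma> * dn (\<phi> + s) k * (k * cn (\<phi> + s) k)) (at s)"
      using DERIV_cmult[OF d(1)[of s], of "?\<sigma> * k"] k01 by (simp add: ac_simps)
    show "((\<lambda>s. ?\<sigma> * dn (\<phi> + s) k) has_real_derivative
        - (?\<sigma> * k * sn (\<phi> + s) k * (k * cn (\<phi> + s) k))) (at s)"
      using DERIV_cmult[OF d(3)[of s], of "?\<sigma>"] k01 by (simp add: ac_simps power2_eq_square)
    have "?\<sigma> * k * sn (\<phi> + s) k * (?\<sigma> * dn (\<phi> + s) k)
        = ?\<sigma>\<^sup>2 * (k * (sn (\<phi> + s) k * dn (\<phi> + s) k))"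
      by (simp only: ac_simps power2_eq_square)
    then show "((\<lambda>s. k * cn (\<phi> + s) k) has_real_derivative
        - (?\<sigma> * k * sn (\<phi> + s) k * (?\<sigma> * dn (\<phi> + s) k))) (at s)"
      using DERIV_cmult[OF d(2)[of s], of k] k01 by (simp only: \<sigma>) simp
  qed (use init in \<open>simp_all add: ac_simps\<close>)
  then show ?thesis using that k01 \<sigma> by blast
qed

text \<open>Along rotations the velocity never vanishes, so its sign \<open>\<sigma>\<close> is a constant of the motion.\<close>

lemma elliptic_flow_C2:
  assumes l: "l \<in> C2" and e: "elliptic_coords l \<phi> k"
  obtains \<sigma> where "0 < k" "k < 1" "\<sigma>\<^sup>2 = 1"
    "half_angle_flow l (\<lambda>s. \<sigma> * sn ((\<phi> + s) / k) k) (\<lambda>s. cn ((\<phi> + s) / k) k)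
       (\<lambda>s. \<sigma> / k * dn ((\<phi> + s) / k) k)"
proof -
  let ?\<sigma> = "sgn (snd l)"
  have E: "1 < energy l" using l by (auto simp: C2_def)
  have k: "k = sqrt (2 / (energy l + 1))" and init: "sin_half (fst l) = ?\<sigma> * sn (\<phi> / k) k"
    "cos_half (fst l) = cn (\<phi> / k) k" "snd l / 2 = ?\<sigma> / k * dn (\<phi> / k) k"
    using e l by (auto simp: elliptic_coords_def Let_def C1_def C2_def C3_def)
  have k01: "0 < k" "k < 1" using E by (auto simp: k)
  have D: "((\<lambda>s. f ((\<phi> + s) / k)) has_real_derivative d / k) (at s)"
    if "(f has_real_derivative d) (at ((\<phi> + s) / k))" for f d s
  proof -
    have "((\<lambda>s. (\<phi> + s) / k) has_real_derivative 1 / k) (at s)"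
      using k01 by (auto intro!: derivative_eq_intros)
    from DERIV_chain2[OF that this] show ?thesis by simp
  qed
  have "snd l \<noteq> 0"
  proof
    assume "snd l = 0"
    then show False
      using E half_angle_energy[of l] cyl_trig(1)[of "fst l"] zero_le_power2[of "cos_half (fst l)"]
      by simp
  qed
  then have \<sigma>: "?\<sigma>\<^sup>2 = 1" by (simp add: sgn_if)
  have k0: "0 \<le> k" using k01 by simp
  note d = D[OF sn_deriv[OF k0 k01(2)]] D[OF cn_deriv[OF k0 k01(2)]] D[OF dn_deriv[OF k0 k01(2)]]
  have "half_angle_flow l (\<lambda>s. ?\<sigma> * sn ((\<phi> + s) / k) k) (\<lambda>s. cn ((\<phi> + s) / k) k)
       (\<lambda>s. ?\<sigma> / k * dn ((\<phi> + s) / k) k)"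
    unfolding half_angle_flow_def
  proof (intro conjI allI)
    fix s
    let ?u = "(\<phi> + s) / k"
    show "((\<lambda>s. ?\<sigma> * sn ((\<phi> + s) / k) k) has_real_derivative
        cn ?u k * (?\<sigma> / k * dn ?u k)) (at s)"
      using DERIV_cmult[OF d(1)[of s], of "?\<sigma>"] k01 by (simp add: ac_simps)
    have "?\<sigma> * sn ?u k * (?\<sigma> / k * dn ?u k) = ?\<sigma>\<^sup>2 * (sn ?u k * dn ?u k / k)"
      by (simp add: ac_simps power2_eq_square)
    then show "((\<lambda>s. cn ((\<phi> + s) / k) k) has_real_derivative
        - (?\<sigma> * sn ?u k * (?\<sigma> / k * dn ?u k))) (at s)"
      using d(2)[of s] k01 by (simp only: \<sigma>) simp
    show "((\<lambda>s. ?\<sigma> / k * dn ((\<phi> + s) / k) k) has_real_derivative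
        - (?\<sigma> * sn ?u k * cn ?u k)) (at s)"
      using DERIV_cmult[OF d(3)[of s], of "?\<sigma> / k"] k01 by (simp add: ac_simps power2_eq_square)
  qed (use init in \<open>simp_all add: ac_simps\<close>)
  then show ?thesis using that k01 \<sigma> by blast
qed

text \<open>On the separatrix the signs of \<open>cos (\<gamma> / 2)\<close> and of \<open>c\<close> are both constants of the motion.\<close>

lemma elliptic_flow_C3:
  assumes l: "l \<in> C3" and e: "elliptic_coords l \<phi> k"
  obtains \<sigma> \<epsilon> where "\<sigma>\<^sup>2 = 1" "\<epsilon>\<^sup>2 = 1"
    "half_angle_flow l (\<lambda>s. \<sigma> * \<epsilon> * tanh (\<phi> + s)) (\<lambda>s. \<sigma> / cosh (\<phi> + s)) (\<lambda>s. \<epsilon> / cosh (\<phi> + s))"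
proof -
  let ?\<sigma> = "sgn (cos_half (fst l))" and ?\<epsilon> = "sgn (snd l)"
  have E: "energy l = 1" "snd l \<noteq> 0" using l by (auto simp: C3_def)
  have init: "sin_half (fst l) = ?\<sigma> * ?\<epsilon> * tanh \<phi>"
    "cos_half (fst l) = ?\<sigma> / cosh \<phi>" "snd l / 2 = ?\<epsilon> / cosh \<phi>"
    using e l by (auto simp: elliptic_coords_def Let_def C1_def C2_def C3_def)
  have "cos_half (fst l) \<noteq> 0"
    using E half_angle_energy[of l] cyl_trig(1)[of "fst l"] by auto
  then have \<sigma>: "?\<sigma>\<^sup>2 = 1" and \<epsilon>: "?\<epsilon>\<^sup>2 = 1" using E by (simp_all add: sgn_if)
  have "half_angle_flow l (\<lambda>s. ?\<sigma> * ?\<epsilon> * tanh (\<phi> + s)) (\<lambda>s. ?\<sigma> / cosh (\<phi> + s))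
      (\<lambda>s. ?\<epsilon> / cosh (\<phi> + s))"
    unfolding half_angle_flow_def
  proof (intro conjI allI)
    fix s
    have ch: "cosh (\<phi> + s) \<noteq> 0" using cosh_real_pos[of "\<phi> + s"] by simp
    have shift: "((\<lambda>s. \<phi> + s) has_real_derivative 1) (at s)"
      by (auto intro!: derivative_eq_intros)
    have "1 - (tanh (\<phi> + s))\<^sup>2
        = ((cosh (\<phi> + s))\<^sup>2 - (sinh (\<phi> + s))\<^sup>2) / (cosh (\<phi> + s))\<^sup>2"
      using ch by (simp add: tanh_def power_divide diff_divide_distrib)
    then have sech2: "1 - (tanh (\<phi> + s))\<^sup>2 = 1 / (cosh (\<phi> + s))\<^sup>2"
      by (simp add: cosh_square_eq)
    have "((\<lambda>s. tanh (\<phi> + s)) has_real_derivative (1 - (tanh (\<phi> + s))\<^sup>2) * 1) (at s)"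
      by (rule derivative_eq_intros shift ch refl)+ simp
    from DERIV_cmult[OF this[unfolded sech2], of "?\<sigma> * ?\<epsilon>"]
    show "((\<lambda>s. ?\<sigma> * ?\<epsilon> * tanh (\<phi> + s)) has_real_derivative
        ?\<sigma> / cosh (\<phi> + s) * (?\<epsilon> / cosh (\<phi> + s))) (at s)"
      by (simp add: power2_eq_square)
    have sech: "((\<lambda>s. a / cosh (\<phi> + s)) has_real_derivative
        - (a * (tanh (\<phi> + s) / cosh (\<phi> + s)))) (at s)" for a
      using ch by (auto intro!: derivative_eq_intros simp: tanh_def power2_eq_square)
    have "?\<sigma> * ?\<epsilon> * tanh (\<phi> + s) * (?\<epsilon> / cosh (\<phi> + s))
        = ?\<epsilon>\<^sup>2 * (?\<sigma> * (tanh (\<phi> + s) / cosh (\<phi> + s)))"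
      by (simp add: ac_simps power2_eq_square)
    then show "((\<lambda>s. ?\<sigma> / cosh (\<phi> + s)) has_real_derivative
        - (?\<sigma> * ?\<epsilon> * tanh (\<phi> + s) * (?\<epsilon> / cosh (\<phi> + s)))) (at s)"
      using sech[of ?\<sigma>] by (simp only: \<epsilon> mult_1)
    have "?\<sigma> * ?\<epsilon> * tanh (\<phi> + s) * (?\<sigma> / cosh (\<phi> + s))
        = ?\<sigma>\<^sup>2 * (?\<epsilon> * (tanh (\<phi> + s) / cosh (\<phi> + s)))"
      by (simp add: ac_simps power2_eq_square)
    then show "((\<lambda>s. ?\<epsilon> / cosh (\<phi> + s)) has_real_derivative
        - (?\<sigma> * ?\<epsilon> * tanh (\<phi> + s) * (?\<sigma> / cosh (\<phi> + s)))) (at s)"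
      using sech[of ?\<epsilon>] by (simp only: \<sigma> mult_1)
  qed (use init in \<open>simp_all add: ac_simps\<close>)
  then show ?thesis using that \<sigma> \<epsilon> by blast
qed

section \<open>The Maxwell sets\<close>

lemma mult_eq_minus_mult_iff: "a * x = - (a * y) \<longleftrightarrow> a = 0 \<or> x = - y" for a x y :: real
  by (metis mult_cancel_left mult_minus_right)

text \<open>The first two reflections preserve the sign of \<open>cos (\<gamma> / 2)\<close>, and \<open>dn\<close> agrees as soon as
  \<open>sn\<^sup>2\<close> does; the third would have to reverse the sign of \<open>dn\<close>, hence has no fixed
  oscillation.\<close>

lemma maxwell_C1:
  assumes l: "l \<in> C1" and t: "0 < t" and e: "elliptic_coords l \<phi> k" and q: "Exp (l, t) = (x, y, z)"
  shows "(l, t) \<in> MAX1 \<longleftrightarrow> R1 (x, y, z) = 0 \<and> cn (tau l \<phi> k t) k \<noteq> 0"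
    and "(l, t) \<in> MAX2 \<longleftrightarrow> z = 0 \<and> sn (tau l \<phi> k t) k \<noteq> 0"
    and "(l, t) \<in> MAX6 \<longleftrightarrow> R2 (x, y, z) = 0"
proof -
  obtain \<sigma> where k: "0 < k" "k < 1" and \<sigma>: "\<sigma>\<^sup>2 = 1"
    and f: "half_angle_flow l (\<lambda>s. \<sigma> * k * sn (\<phi> + s) k) (\<lambda>s. \<sigma> * dn (\<phi> + s) k)
       (\<lambda>s. k * cn (\<phi> + s) k)"
    using elliptic_flow_C1[OF l e] by metis
  have tau: "tau l \<phi> k t = (\<phi> + (\<phi> + t)) / 2"
    using l by (auto simp: tau_def C1_def C2_def)
  have dn: "0 < dn u k" for u using dn_pos k by simp
  have nz: "\<sigma> \<noteq> 0" "k \<noteq> 0" using \<sigma> k by auto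
  have dn_eq: "dn (\<phi> + t) k = dn \<phi> k" if "(sn (\<phi> + t) k)\<^sup>2 = (sn \<phi> k)\<^sup>2"
    using that by (simp add: dn_def)
  note M = maxwell_half_angle[OF f t q] and mid = midpoint_zero_iff[of k \<phi> "\<phi> + t"]
  show "(l, t) \<in> MAX1 \<longleftrightarrow> R1 (x, y, z) = 0 \<and> cn (tau l \<phi> k t) k \<noteq> 0"
    unfolding M tau using mid dn_eq nz k by (auto simp: mult_eq_minus_mult_iff)
  show "(l, t) \<in> MAX2 \<longleftrightarrow> z = 0 \<and> sn (tau l \<phi> k t) k \<noteq> 0"
    unfolding M tau using mid dn_eq nz k by (auto simp: mult_eq_minus_mult_iff)
  have "dn (\<phi> + t) k \<noteq> - dn \<phi> k" using dn[of "\<phi> + t"] dn[of \<phi>] by linarith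
  then show "(l, t) \<in> MAX6 \<longleftrightarrow> R2 (x, y, z) = 0"
    unfolding M using nz by (simp add: mult_eq_minus_mult_iff)
qed

text \<open>Here the velocity is the multiple of \<open>dn\<close>, so it is the first reflection, reversing the
  velocity, that has no fixed point.\<close>

lemma maxwell_C2:
  assumes l: "l \<in> C2" and t: "0 < t" and e: "elliptic_coords l \<phi> k" and q: "Exp (l, t) = (x, y, z)"
  shows "(l, t) \<in> MAX1 \<longleftrightarrow> R1 (x, y, z) = 0"
    and "(l, t) \<in> MAX2 \<longleftrightarrow> z = 0 \<and> sn (tau l \<phi> k t) k \<noteq> 0"
    and "(l, t) \<in> MAX6 \<longleftrightarrow> R2 (x, y, z) = 0 \<and> cn (tau l \<phi> k t) k \<noteq> 0"
proof -
  obtain \<sigma> where k: "0 < k" "k < 1" and \<sigma>: "\<sigma>\<^sup>2 = 1"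
    and f: "half_angle_flow l (\<lambda>s. \<sigma> * sn ((\<phi> + s) / k) k) (\<lambda>s. cn ((\<phi> + s) / k) k)
       (\<lambda>s. \<sigma> / k * dn ((\<phi> + s) / k) k)"
    using elliptic_flow_C2[OF l e] by metis
  have tau: "tau l \<phi> k t = (\<phi> / k + (\<phi> + t) / k) / 2"
    using l k by (simp add: tau_def field_simps)
  have dn: "0 < dn u k" for u using dn_pos k by simp
  have nz: "\<sigma> \<noteq> 0" "k \<noteq> 0" using \<sigma> k by auto
  have dn_eq: "dn ((\<phi> + t) / k) k = dn (\<phi> / k) k"
    if "(sn ((\<phi> + t) / k) k)\<^sup>2 = (sn (\<phi> / k) k)\<^sup>2"
    using that by (simp add: dn_def)
  note M = maxwell_half_angle[OF f t q] and mid = midpoint_zero_iff[of k "\<phi> / k" "(\<phi> + t) / k"]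
  have "\<sigma> / k * dn ((\<phi> + t) / k) k \<noteq> - (\<sigma> / k * dn (\<phi> / k) k)"
    unfolding mult_eq_minus_mult_iff using nz dn[of "(\<phi> + t) / k"] dn[of "\<phi> / k"] by simp
  then show "(l, t) \<in> MAX1 \<longleftrightarrow> R1 (x, y, z) = 0" unfolding M by simp
  show "(l, t) \<in> MAX2 \<longleftrightarrow> z = 0 \<and> sn (tau l \<phi> k t) k \<noteq> 0"
    unfolding M tau using mid dn_eq nz k by (auto simp: mult_eq_minus_mult_iff)
  show "(l, t) \<in> MAX6 \<longleftrightarrow> R2 (x, y, z) = 0 \<and> cn (tau l \<phi> k t) k \<noteq> 0"
    unfolding M tau using mid dn_eq nz k by (auto simp: mult_eq_minus_mult_iff)
qed

text \<open>Both \<open>cos (\<gamma> / 2)\<close> and \<open>c\<close> are nonzero multiples of \<open>1 / cosh\<close>, so the first and the third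
  reflection have no fixed point; the second one is governed by the injective odd function
  \<open>tanh\<close>.\<close>

lemma maxwell_C3:
  assumes l: "l \<in> C3" and t: "0 < t" and e: "elliptic_coords l \<phi> k" and q: "Exp (l, t) = (x, y, z)"
  shows "(l, t) \<in> MAX1 \<longleftrightarrow> R1 (x, y, z) = 0"
    and "(l, t) \<in> MAX2 \<longleftrightarrow> z = 0 \<and> tau l \<phi> k t \<noteq> 0"
    and "(l, t) \<in> MAX6 \<longleftrightarrow> R2 (x, y, z) = 0"
proof -
  obtain \<sigma> \<epsilon> where s: "\<sigma>\<^sup>2 = 1" "\<epsilon>\<^sup>2 = 1"
    and f: "half_angle_flow l (\<lambda>s. \<sigma> * \<epsilon> * tanh (\<phi> + s)) (\<lambda>s. \<sigma> / cosh (\<phi> + s))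
       (\<lambda>s. \<epsilon> / cosh (\<phi> + s))"
    using elliptic_flow_C3[OF l e] by metis
  have tau: "tau l \<phi> k t = 0 \<longleftrightarrow> \<phi> + t = - \<phi>"
    using l by (auto simp: tau_def C3_def C2_def)
  have nz: "\<sigma> \<noteq> 0" "\<epsilon> \<noteq> 0" using s by auto
  have sech: "0 < 1 / cosh u" for u :: real by (simp add: cosh_real_pos)
  have tanh: "tanh (\<phi> + t) = - tanh \<phi> \<longleftrightarrow> \<phi> + t = - \<phi>"
    by (metis tanh_minus tanh_real_eq_iff)
  note M = maxwell_half_angle[OF f t q]
  have ne: "a / cosh (\<phi> + t) \<noteq> - (a / cosh \<phi>)" if "a \<noteq> 0" for a
  proof
    assume "a / cosh (\<phi> + t) = - (a / cosh \<phi>)"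
    then have "a * (1 / cosh (\<phi> + t) + 1 / cosh \<phi>) = 0" by (simp add: distrib_left)
    then have "1 / cosh (\<phi> + t) + 1 / cosh \<phi> = 0" using that by (simp only: mult_eq_0_iff) simp
    then show False using sech[of "\<phi> + t"] sech[of \<phi>] by linarith
  qed
  show "(l, t) \<in> MAX1 \<longleftrightarrow> R1 (x, y, z) = 0" unfolding M using ne[OF nz(2)] by simp
  show "(l, t) \<in> MAX2 \<longleftrightarrow> z = 0 \<and> tau l \<phi> k t \<noteq> 0"
    unfolding M tau using nz tanh by (auto simp: mult_eq_minus_mult_iff)
  show "(l, t) \<in> MAX6 \<longleftrightarrow> R2 (x, y, z) = 0" unfolding M using ne[OF nz(1)] by simp
qed

theorem proposition7p3:
  fixes l :: phase and t \<phi> k \<tau> x y z :: real and \<nu> :: "phase \<times> real"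
    and q :: "real \<times> real \<times> real"
  assumes "\<nu> = (l, t)"
    and "\<nu> \<in> N1 \<union> N2 \<union> N3"
    and "elliptic_coords l \<phi> k"
    and "\<tau> = tau l \<phi> k t"
    and "q = Exp \<nu>"
    and "q = (x, y, z)"
  shows "(l \<in> C1 \<longrightarrow> (\<nu> \<in> MAX1 \<longleftrightarrow> R1 q = 0 \<and> cn \<tau> k \<noteq> 0))
       \<and> (l \<in> C2 \<union> C3 \<longrightarrow> (\<nu> \<in> MAX1 \<longleftrightarrow> R1 q = 0))
       \<and> (l \<in> C1 \<union> C2 \<longrightarrow> (\<nu> \<in> MAX2 \<longleftrightarrow> z = 0 \<and> sn \<tau> k \<noteq> 0))
       \<and> (l \<in> C3 \<longrightarrow> (\<nu> \<in> MAX2 \<longleftrightarrow> z = 0 \<and> \<tau> \<noteq> 0))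
       \<and> (l \<in> C2 \<longrightarrow> (\<nu> \<in> MAX6 \<longleftrightarrow> R2 q = 0 \<and> cn \<tau> k \<noteq> 0))
       \<and> (l \<in> C1 \<union> C3 \<longrightarrow> (\<nu> \<in> MAX6 \<longleftrightarrow> R2 q = 0))"
proof -
  have q: "Exp (l, t) = (x, y, z)" and qx: "q = (x, y, z)" using assms by simp_all
  have t: "0 < t" using assms by (auto simp: N1_def N2_def N3_def)
  note e = assms(3)
  show ?thesis
    unfolding assms(1,4) qx
    using maxwell_C1[OF _ t e q] maxwell_C2[OF _ t e q] maxwell_C3[OF _ t e q] by blast
qed

end
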